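(* Let $\pi$ be a minimal valid function that is piecewise linear over $\mathcal{P}_B$, and let $\bar\pi=\bar\pi^{\mathrm{pwl}}+\bar\pi^{\mathrm{micro}}$ be a restricted locally quasimicroperiodic function over the same complex $\mathcal{P}_B$, with $\bar\pi(0)=\bar\pi(f)=0$. Then $\bar\pi\in\tilde\Pi^{\pi}(\mathbb{R},\mathbb{Z})$ (that is, $\bar\pi$ is an effective perturbation function for $\pi$) if and only if both of the following hold: (1) for any face $F$ of $\Delta\mathcal{P}_B$ and any $(u,v)\in F$ satisfying $\Delta\pi_F(u,v)=0$, we have $\Delta\bar\pi_F(u,v)=0$; and (2) for any face $F$ of $\Delta\mathcal{P}_B$ of positive dimension such that there exists $(u,v)\in F$ satisfying $\Delta\pi_F(u,v)=0$, we have $\Delta\bar\pi^{\mathrm{micro}}_F(x,y)=0$ for all $(x,y)\in F$.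
   Context: Fix $f\in(0,1)$. A minimal valid function is a function $\pi\colon\mathbb{R}\to[0,1]$ that is $\mathbb{Z}$-periodic, subadditive, with $\pi(0)=0$, $\pi(f)=1$, and satisfying the symmetry condition $\pi(x)+\pi(f-x)=1$ for all $x\in\mathbb{R}$. A function $\tilde\pi\colon\mathbb{R}\to\mathbb{R}$ is an effective perturbation function for $\pi$, written $\tilde\pi\in\tilde\Pi^{\pi}(\mathbb{R},\mathbb{Z})$, if there exists $\epsilon>0$ such that $\pi+\epsilon\tilde\pi$ and $\pi-\epsilon\tilde\pi$ are both minimal valid functions. One-dimensional complex: for $0=x_0<x_1<\dots<x_n=1$ let $B=\{x_i+t : 0\le i\le n-1,\ t\in\mathbb{Z}\}$ (the breakpoints). $\mathcal{P}_B$ consists of the empty face, the singletons $\{x\}$, $x\in B$, and the closed intervals $[x_i+t,x_{i+1}+t]$, $0\le i\le n-1$, $t\in\mathbb{Z}$. A function $\mathbb{R}\to\mathbb{R}$ is piecewise linear over $\mathcal{P}_B$ if on the relative interior of each face of $\mathcal{P}_B$ it coincides with an affine linear function (so it may be discontinuous at breakpoints). Two-dimensional complex: $\Delta\mathcal{P}_B$ is the polyhedral complex whose faces are the sets $F(I,J,K)=\{(x,y)\in\mathbb{R}^2 : x\in I,\ y\in J,\ x+y\in K\}$ with $I,J,K\in\mathcal{P}_B$. Slack: for any function $\theta\colon\mathbb{R}\to\mathbb{R}$, $\Delta\theta(x,y)=\theta(x)+\theta(y)-\theta(x+y)$, and for a face $F$ and $(u,v)\in F$, $\Delta\theta_F(u,v)=\lim_{(x,y)\to(u,v),\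 (x,y)\in\operatorname{rel\,int}(F)}\Delta\theta(x,y)$, where $(x,y)=(u,v)$ is allowed when $(u,v)\in\operatorname{rel\,int}(F)$; if $F$ is a single point this is just the value $\Delta\theta(u,v)$. For $\theta=\pi$ the limit always exists; for $\theta=\bar\pi,\bar\pi^{\mathrm{micro}}$, an equation $\Delta\theta_F(u,v)=0$ means that the limit exists and equals $0$. Restricted locally quasimicroperiodic functions: let $T=\langle t_1,\dots,t_n\rangle_{\mathbb{Z}}$ be a finitely generated additive subgroup of $\mathbb{R}$ that is dense in $\mathbb{R}$. A restricted locally quasimicroperiodic function over $\mathcal{P}_B$ is a $\mathbb{Z}$-periodic function $\bar\pi=\bar\pi^{\mathrm{pwl}}+\bar\pi^{\mathrm{micro}}$, with both summands $\mathbb{Z}$-periodic, where $\bar\pi^{\mathrm{pwl}}$ is (possibly discontinuous) piecewise linear over $\mathcal{P}_B$, and $\bar\pi^{\mathrm{micro}}$ satisfies: $\bar\pi^{\mathrm{micro}}(x)=0$ at every breakpoint $x\in B$; and for each closed interval $I=[x_i,x_{i+1}]\subseteq[0,1]$ of $\mathcal{P}_B$ there are $m_I\in\mathbb{Z}_+$ (possibly $0$), nonzero reals $c^I_1,\dots,c^I_{m_I}$, and reals $b^I_1,\dots,b^I_{m_I}$ with $b^I_i-b^I_j\notin T$ for $i\ne j$, such that for $x\in\operatorname{int}(I)$, $\bar\pi^{\mathrm{micro}}(x)=c^I_i$ if $x\in b^I_i+T$ ($i=1,\dots,m_I$), and $\bar\pi^{\mathrm{micro}}(x)=0$ otherwise.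 *)

theory Defs
  imports
    "HOL-Analysis.Analysis"
    "HOL-Computational_Algebra.Group_Closure"
begin

definition int_periodic :: "(real \<Rightarrow> real) \<Rightarrow> bool" where
  "int_periodic \<theta> \<longleftrightarrow> (\<forall>x. \<forall>t::int. \<theta> (x + of_int t) = \<theta> x)"

definition minimal_valid :: "real \<Rightarrow> (real \<Rightarrow> real) \<Rightarrow> bool" where
  "minimal_valid f \<theta> \<longleftrightarrow>
     (\<forall>x. 0 \<le> \<theta> x \<and> \<theta> x \<le> 1) \<and>
     int_periodic \<theta> \<and>
     (\<forall>x y. \<theta> (x + y) \<le> \<theta> x + \<theta> y) \<and>
     \<theta> 0 = 0 \<and> \<theta> f = 1 \<and>
     (\<forall>x. \<theta> x + \<theta> (f - x) = 1)"

definition effective_perturbations :: "real \<Rightarrow> (real \<Rightarrow> real) \<Rightarrow> (real \<Rightarrow> real) set" where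
  "effective_perturbations f \<theta> =
     {p. \<exists>\<epsilon>>0. minimal_valid f (\<lambda>x. \<theta> x + \<epsilon> * p x) \<and>
                minimal_valid f (\<lambda>x. \<theta> x - \<epsilon> * p x)}"


definition breakpoint_seq :: "nat \<Rightarrow> (nat \<Rightarrow> real) \<Rightarrow> bool" where
  "breakpoint_seq n xs \<longleftrightarrow> xs 0 = 0 \<and> xs n = 1 \<and> (\<forall>i<n. xs i < xs (Suc i))"

definition breakpoints :: "nat \<Rightarrow> (nat \<Rightarrow> real) \<Rightarrow> real set" where
  "breakpoints n xs = {xs i + of_int t | i t. i < n}"

definition complex1 :: "nat \<Rightarrow> (nat \<Rightarrow> real) \<Rightarrow> real set set" where
  "complex1 n xs =
     {{}} \<union> {{x} | x. x \<in> breakpoints n xs} \<union>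
     {{xs i + of_int t .. xs (Suc i) + of_int t} | i t. i < n}"

definition piecewise_linear :: "nat \<Rightarrow> (nat \<Rightarrow> real) \<Rightarrow> (real \<Rightarrow> real) \<Rightarrow> bool" where
  "piecewise_linear n xs \<theta> \<longleftrightarrow>
     (\<forall>I\<in>complex1 n xs. \<exists>a b. \<forall>x\<in>rel_interior I. \<theta> x = a * x + b)"

definition complex2 :: "nat \<Rightarrow> (nat \<Rightarrow> real) \<Rightarrow> (real \<times> real) set set" where
  "complex2 n xs =
     {{(x, y). x \<in> I \<and> y \<in> J \<and> x + y \<in> K} | I J K.
        I \<in> complex1 n xs \<and> J \<in> complex1 n xs \<and> K \<in> complex1 n xs}"


definition slack :: "(real \<Rightarrow> real) \<Rightarrow> real \<times> real \<Rightarrow> real" where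
  "slack \<theta> = (\<lambda>(x, y). \<theta> x + \<theta> y - \<theta> (x + y))"

text \<open>
  The limit exists and equals \<open>l\<close>. The filter is \<open>at p within rel_interior F\<close>
  with \<open>p\<close> itself not excluded: if \<open>p\<close> lies in the relative interior, the limit,
  if it exists, is the value at \<open>p\<close>; in particular this covers one-point faces.
  For a nonempty convex \<open>F\<close> and \<open>p \<in> F\<close> the filter is nontrivial, so \<open>l\<close> is unique.
\<close>
definition slack_limit :: "(real \<Rightarrow> real) \<Rightarrow> (real \<times> real) set \<Rightarrow> real \<times> real \<Rightarrow> real \<Rightarrow> bool" where
  "slack_limit \<theta> F p l \<longleftrightarrow>
     (slack \<theta> \<longlongrightarrow> l) (inf (nhds p) (principal (rel_interior F)))"


text \<open>
  Here \<open>micro\<close> is the locally quasimicroperiodic summand; \<open>x \<in> b i + T\<close> is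
  written as \<open>x - b i \<in> T\<close>.
\<close>
definition restricted_micro :: "nat \<Rightarrow> (nat \<Rightarrow> real) \<Rightarrow> real set \<Rightarrow> (real \<Rightarrow> real) \<Rightarrow> bool" where
  "restricted_micro n xs T micro \<longleftrightarrow>
     int_periodic micro \<and>
     (\<forall>x\<in>breakpoints n xs. micro x = 0) \<and>
     (\<forall>k<n. \<exists>(m::nat) (c::nat \<Rightarrow> real) (b::nat \<Rightarrow> real).
        (\<forall>i<m. c i \<noteq> 0) \<and>
        (\<forall>i<m. \<forall>j<m. i \<noteq> j \<longrightarrow> b i - b j \<notin> T) \<and>
        (\<forall>x\<in>interior {xs k .. xs (Suc k)}.
           (\<forall>i<m. x - b i \<in> T \<longrightarrow> micro x = c i) \<and>
           ((\<forall>i<m. x - b i \<notin> T) \<longrightarrow> micro x = 0)))"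

definition restricted_lqmp ::
  "nat \<Rightarrow> (nat \<Rightarrow> real) \<Rightarrow> real set \<Rightarrow> (real \<Rightarrow> real) \<Rightarrow> (real \<Rightarrow> real) \<Rightarrow> (real \<Rightarrow> real) \<Rightarrow> bool" where
  "restricted_lqmp n xs T \<theta> pwl micro \<longleftrightarrow>
     (\<forall>x. \<theta> x = pwl x + micro x) \<and>
     int_periodic pwl \<and> piecewise_linear n xs pwl \<and>
     restricted_micro n xs T micro"

end

theory Submission
  imports Defs
begin

text \<open>
  A function is an effective perturbation of \<open>\<pi>\<close> precisely when its slack is dominated by a
  multiple of the slack of \<open>\<pi>\<close>, up to periodicity, boundedness and the symmetry condition. Both
  directions of the theorem are about this domination, face by face.

  Necessity. Domination forces the limit slack of the perturbation to vanish wherever that of \<open>\<pi>\<close>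
  does. On a face the slack of a piecewise linear function is affine, so the
  microperiodic slack then also has a limit at that point. Its values are unchanged under
  translations along the face by elements of the dense group \<open>T\<close>, so every value on the
  relative interior recurs arbitrarily close to the limit point and must equal the limit. The
  microperiodic summand has countable support, so at some point of the face the slack is \<open>0\<close>
  (\<open>restricted_micro_slack_zero_if_limit\<close>). This needs that a coordinate that is constant on a face of
  positive dimension is a breakpoint (\<open>complex2_directions\<close>).

  Sufficiency. On a face where the limit slack of \<open>\<pi>\<close> is positive, it is bounded below by
  compactness, while the perturbation is bounded. On a face of positive dimension where it vanishes
  somewhere, the second condition makes the slack of the perturbation affine, and the first
  condition makes it vanish where that of \<open>\<pi>\<close> does; two affine functions on a polytope in this
  relation are comparable, by looking at the vertices (\<open>slack_dominated_on_face\<close>). Modulo integer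
  translations there are finitely many faces (\<open>slack_dominated\<close>). The symmetry condition is additivity on
  the lines \<open>x + y = f\<close>, which are unions of faces because \<open>f\<close> is a breakpoint
  (\<open>minimal_valid_f_breakpoint\<close>); the bounds \<open>0\<close> and \<open>1\<close> come for free
  (\<open>minimal_valid_perturbation\<close>).
\<close>

section \<open>Dense subgroups and generic points\<close>

lemma countable_group_closure:
  fixes G :: "'a::ab_group_add set"
  assumes "countable G"
  shows "countable (group_closure G)"
proof -
  have neg: "sum_list (map uminus l) = - sum_list l" for l :: "'a list"
    by (induction l) auto
  have "\<exists>l\<in>lists (G \<union> uminus ` G). x = sum_list l" if "x \<in> group_closure G" for x
    using that
  proof induction
    case (base s)
    show ?case
    proof (cases "s = 0")
      case True
      then show ?thesis by (intro bexI[of _ "[]"]) auto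
    next
      case False
      with base show ?thesis by (intro bexI[of _ "[s]"]) auto
    qed
  next
    case (diff s t)
    then obtain l l' where "l \<in> lists (G \<union> uminus ` G)" "s = sum_list l"
      and "l' \<in> lists (G \<union> uminus ` G)" "t = sum_list l'"
      by blast
    then show ?case
      by (intro bexI[of _ "l @ map uminus l'"]) (force simp: neg)+
  qed
  then have "group_closure G \<subseteq> sum_list ` lists (G \<union> uminus ` G)"
    by blast
  moreover have "countable (sum_list ` lists (G \<union> uminus ` G))"
    using assms by simp
  ultimately show ?thesis
    by (rule countable_subset)
qed

text \<open>
  A nonconstant affine form takes any prescribed value only on a hyperplane, and countably many
  hyperplanes are negligible while a nonempty open set is not.
\<close>
lemma negligible_countable_level_sets:
  fixes v :: "'a::euclidean_space"
  assumes "countable N" "v \<noteq> 0"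
  shows "negligible {w. c + v \<bullet> w \<in> N}"
proof -
  have "negligible (\<Union>z\<in>N. {w. v \<bullet> w = z - c})"
  proof (rule negligible_countable_Union)
    show "countable ((\<lambda>z. {w. v \<bullet> w = z - c}) ` N)"
      using assms by simp
  qed (use assms in \<open>auto intro: negligible_hyperplane\<close>)
  moreover have "{w. c + v \<bullet> w \<in> N} \<subseteq> (\<Union>z\<in>N. {w. v \<bullet> w = z - c})"
    by auto
  ultimately show ?thesis
    by (rule negligible_subset)
qed

section \<open>Limits of slacks\<close>

lemma slack_eq: "slack \<theta> p = \<theta> (fst p) + \<theta> (snd p) - \<theta> (fst p + snd p)"
  by (simp add: slack_def case_prod_beta)

lemma slack_limit_at_point:
  assumes "slack_limit \<theta> F p l" "p \<in> rel_interior F"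
  shows "slack \<theta> p = l"
proof -
  have "principal {p} \<le> inf (nhds p) (principal (rel_interior F))"
    using assms(2) by (auto simp: le_filter_def eventually_inf_principal eventually_principal
        dest: eventually_nhds_x_imp_x)
  then have "(slack \<theta> \<longlongrightarrow> l) (principal {p})"
    using assms(1) unfolding slack_limit_def by (rule tendsto_mono)
  then have "eventually (\<lambda>q. slack \<theta> q \<in> {z. dist z l < e}) (principal {p})" if "e > 0" for e
    using that by (auto dest: tendstoD)
  then have "dist (slack \<theta> p) l < e" if "e > 0" for e
    using that by (auto simp: eventually_principal)
  then show ?thesis
    by (metis dist_nz less_irrefl)
qed

text \<open>This makes limits of slacks at points of a face unique.\<close>
lemma slack_limit_nontrivial:
  fixes F :: "(real \<times> real) set"
  assumes "convex F" "p \<in> F"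
  shows "inf (nhds p) (principal (rel_interior F)) \<noteq> bot"
proof
  assume "inf (nhds p) (principal (rel_interior F)) = bot"
  then have "eventually (\<lambda>q. False) (inf (nhds p) (principal (rel_interior F)))"
    by simp
  then have "eventually (\<lambda>q. q \<notin> rel_interior F) (nhds p)"
    by (simp add: eventually_inf_principal)
  then obtain S where S: "open S" "p \<in> S" "\<forall>q\<in>S. q \<notin> rel_interior F"
    by (auto simp: eventually_nhds)
  have "p \<in> closure (rel_interior F)"
    using assms convex_closure_rel_interior closure_subset by blast
  then show False
    using S open_Int_closure_eq_empty[OF S(1), of "rel_interior F"] by blast
qed

lemma slack_limit_affine:
  assumes "\<And>q. q \<in> rel_interior F \<Longrightarrow> slack \<theta> q = v \<bullet> q + c"
  shows "slack_limit \<theta> F p (v \<bullet> p + c)"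
proof -
  have "((\<lambda>q. v \<bullet> q + c) \<longlongrightarrow> v \<bullet> p + c) (nhds p)"
    by (intro tendsto_intros filterlim_ident)
  then have "((\<lambda>q. v \<bullet> q + c) \<longlongrightarrow> v \<bullet> p + c) (inf (nhds p) (principal (rel_interior F)))"
    by (rule tendsto_mono[OF inf_le1])
  moreover have "eventually (\<lambda>q. slack \<theta> q = v \<bullet> q + c) (inf (nhds p) (principal (rel_interior F)))"
    using assms by (simp add: eventually_inf_principal)
  ultimately show ?thesis
    unfolding slack_limit_def using tendsto_cong[of "slack \<theta>"] by fastforce
qed

lemma slack_limit_unique:
  assumes "convex F" "p \<in> F" "slack_limit \<theta> F p l" "slack_limit \<theta> F p l'"
  shows "l = l'"
  using assms slack_limit_nontrivial tendsto_unique unfolding slack_limit_def by blast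

lemma slack_limit_zero_if_dominated:
  assumes "\<And>q. \<bar>slack \<rho> q\<bar> \<le> C * slack \<theta> q" "slack_limit \<theta> F p 0"
  shows "slack_limit \<rho> F p 0"
  unfolding slack_limit_def
proof (rule Lim_null_comparison)
  show "\<forall>\<^sub>F q in inf (nhds p) (principal (rel_interior F)). norm (slack \<rho> q) \<le> C * slack \<theta> q"
    using assms(1) by simp
  have "((\<lambda>q. C * slack \<theta> q) \<longlongrightarrow> C * 0) (inf (nhds p) (principal (rel_interior F)))"
    by (intro tendsto_intros) (use assms(2) in \<open>simp add: slack_limit_def\<close>)
  then show "((\<lambda>q. C * slack \<theta> q) \<longlongrightarrow> 0) (inf (nhds p) (principal (rel_interior F)))"
    by simp
qed

text \<open>
  On a face the slack of a piecewise linear function agrees with an affine function, so that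
  removing it from a sum does not affect the existence of the limit of the rest.
\<close>
lemma slack_limit_remove_affine:
  assumes "\<And>x. \<theta> x = \<rho> x + \<mu> x"
    and "\<And>q. q \<in> rel_interior F \<Longrightarrow> slack \<rho> q = v \<bullet> q + c"
    and "slack_limit \<theta> F p l"
  shows "slack_limit \<mu> F p (l - (v \<bullet> p + c))"
proof -
  have "slack_limit \<rho> F p (v \<bullet> p + c)"
    using assms(2) by (rule slack_limit_affine)
  then have "((\<lambda>q. slack \<theta> q - slack \<rho> q) \<longlongrightarrow> l - (v \<bullet> p + c))
      (inf (nhds p) (principal (rel_interior F)))"
    using assms(3) unfolding slack_limit_def by (intro tendsto_diff)
  moreover have "(\<lambda>q. slack \<theta> q - slack \<rho> q) = slack \<mu>"
    by (auto simp: slack_eq assms(1))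
  ultimately show ?thesis
    by (simp add: slack_limit_def)
qed

text \<open>A limit must agree with a value that is taken arbitrarily close to the limit point.\<close>
lemma slack_limit_frequent_value:
  assumes lim: "slack_limit \<theta> F p l"
    and freq: "\<And>U. open U \<Longrightarrow> p \<in> U \<Longrightarrow> \<exists>q\<in>U \<inter> rel_interior F. slack \<theta> q = z"
  shows "z = l"
proof (rule ccontr)
  assume "z \<noteq> l"
  then have "eventually (\<lambda>q. slack \<theta> q \<in> - {z}) (inf (nhds p) (principal (rel_interior F)))"
    using lim unfolding slack_limit_def by (intro topological_tendstoD) auto
  then obtain U where "open U" "p \<in> U" "\<forall>q\<in>U. q \<in> rel_interior F \<longrightarrow> slack \<theta> q \<noteq> z"
    by (auto simp: eventually_inf_principal eventually_nhds)
  then show False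
    using freq by blast
qed

section \<open>Faces of the two complexes\<close>

definition face2 :: "real set \<Rightarrow> real set \<Rightarrow> real set \<Rightarrow> (real \<times> real) set" where
  "face2 I J K = {(x, y). x \<in> I \<and> y \<in> J \<and> x + y \<in> K}"

lemma in_face2 [simp]: "p \<in> face2 I J K \<longleftrightarrow> fst p \<in> I \<and> snd p \<in> J \<and> fst p + snd p \<in> K"
  by (auto simp: face2_def)

lemma complex2_face2:
  "F \<in> complex2 n xs \<longleftrightarrow>
    (\<exists>I\<in>complex1 n xs. \<exists>J\<in>complex1 n xs. \<exists>K\<in>complex1 n xs. F = face2 I J K)"
  unfolding complex2_def face2_def by blast

text \<open>
  As the preimage of a box under a linear map, the set inherits convexity from its factors, and its
  relative interior is the preimage of that of the box when this preimage is nonempty.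
\<close>
lemma face2_vimage: "face2 I J K = (\<lambda>p. (fst p, snd p, fst p + snd p)) -` (I \<times> J \<times> K)"
  by (auto simp: face2_def)

lemma linear_face2_map: "linear (\<lambda>p::real \<times> real. (fst p, snd p, fst p + snd p))"
  by (intro linearI) (auto simp: algebra_simps)

lemma convex_face2:
  assumes "convex I" "convex J" "convex K"
  shows "convex (face2 I J K)"
  unfolding face2_vimage using assms
  by (intro convex_linear_vimage linear_face2_map convex_Times)

lemma rel_interior_face2:
  assumes "convex I" "convex J" "convex K"
    and "face2 (rel_interior I) (rel_interior J) (rel_interior K) \<noteq> {}"
  shows "rel_interior (face2 I J K) = face2 (rel_interior I) (rel_interior J) (rel_interior K)"
  using rel_interior_convex_linear_preimage[OF linear_face2_map, of "I \<times> J \<times> K"] assms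
  by (simp add: face2_vimage rel_interior_Times convex_Times)

lemma complex1_cases [consumes 3, case_names point interval]:
  assumes "breakpoint_seq n xs" "I \<in> complex1 n xs" "I \<noteq> {}"
  obtains (point) a where "I = {a}" "a \<in> breakpoints n xs"
  | (interval) k t where "k < n" "I = {xs k + of_int t .. xs (Suc k) + of_int t}"
      "xs k + of_int t < xs (Suc k) + of_int t"
  using assms unfolding complex1_def breakpoint_seq_def by force

lemma breakpoint_interval_ends:
  assumes "breakpoint_seq n xs" "k < n"
  shows "xs k + of_int t \<in> breakpoints n xs" "xs (Suc k) + of_int t \<in> breakpoints n xs"
proof -
  show "xs k + of_int t \<in> breakpoints n xs"
    using assms unfolding breakpoints_def by blast
  show "xs (Suc k) + of_int t \<in> breakpoints n xs"
  proof (cases "Suc k < n")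
    case True
    then show ?thesis unfolding breakpoints_def by blast
  next
    case False
    with assms have "xs (Suc k) = 1" "xs 0 = 0"
      by (auto simp: breakpoint_seq_def not_less less_Suc_eq_le le_antisym)
        (metis Suc_leI le_antisym)
    then have "xs (Suc k) + of_int t = xs 0 + of_int (t + 1)"
      by simp
    then show ?thesis
      using assms unfolding breakpoints_def by (metis (mono_tags, lifting) gr_zeroI mem_Collect_eq not_less0)
  qed
qed

lemma cells_complex1:
  assumes "k < n"
  shows "{xs k + of_int t} \<in> complex1 n xs"
    "{xs k + of_int t .. xs (Suc k) + of_int t} \<in> complex1 n xs"
  using assms unfolding complex1_def breakpoints_def by blast+

lemma convex_complex1: "I \<in> complex1 n xs \<Longrightarrow> convex I"
  unfolding complex1_def by auto

lemma convex_complex2: "F \<in> complex2 n xs \<Longrightarrow> convex F"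
  by (auto simp: complex2_face2 convex_complex1 intro!: convex_face2)

text \<open>
  The face with \<open>x\<close> in its relative interior contains every segment of \<open>I\<close> that can be prolonged
  beyond \<open>x\<close>, because an endpoint of an interval is never an inner point of a nondegenerate
  segment in it. The hypothesis on \<open>y\<close> and \<open>e\<close> has the form in which
  \<open>convex_rel_interior_iff\<close> supplies such segments.
\<close>
lemma carrier_face1:
  assumes "breakpoint_seq n xs" "I \<in> complex1 n xs" "x \<in> I"
  obtains I' where "I' \<in> complex1 n xs" "I' \<subseteq> I" "x \<in> rel_interior I'"
    "\<And>y e. \<lbrakk>y \<in> I; 1 < e; (1 - e) * y + e * x \<in> I\<rbrakk> \<Longrightarrow> y \<in> I'"
proof -
  have sing: "{a} \<in> complex1 n xs" if "a \<in> breakpoints n xs" for a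
    using that by (auto simp: complex1_def)
  have "I \<noteq> {}"
    using assms(3) by blast
  with assms(1,2) show ?thesis
  proof (cases rule: complex1_cases)
    case (point a)
    then show ?thesis
      using assms by (intro that[of I]) auto
  next
    case (interval k t)
    define a b where "a = xs k + of_int t" and "b = xs (Suc k) + of_int t"
    have I: "I = {a..b}" "a < b"
      using interval by (auto simp: a_def b_def)
    have ends: "{a} \<in> complex1 n xs" "{b} \<in> complex1 n xs"
      using breakpoint_interval_ends[OF assms(1) interval(1)] sing by (auto simp: a_def b_def)
    consider "x = a" | "x = b" | "a < x" "x < b"
      using assms(3) I by fastforce
    then show ?thesis
    proof cases
      case 1
      have only_end: "y = a" if "y \<in> I" "1 < e" "(1 - e) * y + e * x \<in> I" for y e
      proof -
        have "(e - 1) * (y - a) \<le> 0"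
          using that 1 I by (simp add: algebra_simps)
        with that have "y \<le> a"
          by (simp add: mult_le_0_iff)
        with that I show ?thesis by simp
      qed
      show ?thesis
      proof (rule that[of "{a}"])
        show "{a} \<in> complex1 n xs" "{a} \<subseteq> I" "x \<in> rel_interior {a}"
          using 1 I ends by auto
      qed (use only_end in blast)
    next
      case 2
      have only_end: "y = b" if "y \<in> I" "1 < e" "(1 - e) * y + e * x \<in> I" for y e
      proof -
        have "(e - 1) * (b - y) \<le> 0"
          using that 2 I by (simp add: algebra_simps)
        with that have "b \<le> y"
          by (simp add: mult_le_0_iff)
        with that I show ?thesis by simp
      qed
      show ?thesis
      proof (rule that[of "{b}"])
        show "{b} \<in> complex1 n xs" "{b} \<subseteq> I" "x \<in> rel_interior {b}"
          using 2 I ends by auto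
      qed (use only_end in blast)
    next
      case 3
      with I assms(2) show ?thesis
        by (intro that[of I]) auto
    qed
  qed
qed

text \<open>
  Different triples may describe the same face. Choosing the carriers of the coordinates of one
  relative interior point gives a triple whose open cells meet; then the relative interior of the
  face can be computed coordinatewise.
\<close>
lemma complex2_reduced:
  assumes "breakpoint_seq n xs" "F \<in> complex2 n xs" "F \<noteq> {}"
  obtains I J K where "I \<in> complex1 n xs" "J \<in> complex1 n xs" "K \<in> complex1 n xs"
    "F = face2 I J K"
    "rel_interior F = face2 (rel_interior I) (rel_interior J) (rel_interior K)"
    "rel_interior F \<noteq> {}"
proof -
  obtain I J K where IJK: "I \<in> complex1 n xs" "J \<in> complex1 n xs" "K \<in> complex1 n xs"
    and F: "F = face2 I J K"
    using assms(2) by (auto simp: complex2_face2)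
  have conv: "convex F"
    using assms(2) by (rule convex_complex2)
  then obtain p where p: "p \<in> rel_interior F"
    using assms(3) rel_interior_eq_empty by blast
  then have "p \<in> F"
    using rel_interior_subset by blast
  then have pI: "fst p \<in> I" and pJ: "snd p \<in> J" and pK: "fst p + snd p \<in> K"
    by (auto simp: F)
  obtain I' where I': "I' \<in> complex1 n xs" "I' \<subseteq> I" "fst p \<in> rel_interior I'"
    "\<And>y e. \<lbrakk>y \<in> I; 1 < e; (1 - e) * y + e * fst p \<in> I\<rbrakk> \<Longrightarrow> y \<in> I'"
    using carrier_face1[OF assms(1) IJK(1) pI] by metis
  obtain J' where J': "J' \<in> complex1 n xs" "J' \<subseteq> J" "snd p \<in> rel_interior J'"
    "\<And>y e. \<lbrakk>y \<in> J; 1 < e; (1 - e) * y + e * snd p \<in> J\<rbrakk> \<Longrightarrow> y \<in> J'"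
    using carrier_face1[OF assms(1) IJK(2) pJ] by metis
  obtain K' where K': "K' \<in> complex1 n xs" "K' \<subseteq> K" "fst p + snd p \<in> rel_interior K'"
    "\<And>y e. \<lbrakk>y \<in> K; 1 < e; (1 - e) * y + e * (fst p + snd p) \<in> K\<rbrakk> \<Longrightarrow> y \<in> K'"
    using carrier_face1[OF assms(1) IJK(3) pK] by metis
  have "q \<in> face2 I' J' K'" if q: "q \<in> F" for q
  proof -
    obtain e where e: "1 < e" "(1 - e) *\<^sub>R q + e *\<^sub>R p \<in> F"
      using p q convex_rel_interior_iff[OF conv assms(3)] by blast
    have "(1 - e) * (fst q + snd q) + e * (fst p + snd p) \<in> K"
      using e by (simp add: F algebra_simps)
    then show ?thesis
      using e q I'(4) J'(4) K'(4) by (auto simp: F)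
  qed
  then have F': "F = face2 I' J' K'"
    using I'(2) J'(2) K'(2) by (auto simp: F)
  have ne: "p \<in> face2 (rel_interior I') (rel_interior J') (rel_interior K')"
    using I' J' K' by simp
  then have "rel_interior F = face2 (rel_interior I') (rel_interior J') (rel_interior K')"
    unfolding F' using I' J' K' convex_complex1 by (intro rel_interior_face2) blast+
  then show ?thesis
    using that I' J' K' F' ne p by blast
qed

text \<open>
  The translation is the integer part of \<open>x\<close>, so that a bounded set of points needs only
  finitely many cells.
\<close>
lemma carrier_face_exists:
  assumes "breakpoint_seq n xs"
  obtains k t where "k < n" "t = \<lfloor>x\<rfloor>"
    "x = xs k + of_int t \<or> xs k + of_int t < x \<and> x < xs (Suc k) + of_int t"
proof -
  define z where "z = x - of_int \<lfloor>x\<rfloor>"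
  have z: "xs 0 \<le> z" "z < xs n"
    using assms by (auto simp: z_def breakpoint_seq_def) linarith
  have "\<exists>k<m. xs k \<le> z \<and> z < xs (Suc k)" if "z < xs m" for m
    using that z(1)
  proof (induction m)
    case 0
    then show ?case by simp
  next
    case (Suc m)
    then show ?case
      by (cases "z < xs m") (auto intro: less_SucI)
  qed
  then obtain k where "k < n" "xs k \<le> z" "z < xs (Suc k)"
    using z by blast
  then show ?thesis
    by (intro that[of k "\<lfloor>x\<rfloor>"]) (auto simp: z_def)
qed

section \<open>Piecewise linear and microperiodic functions on faces\<close>

lemma piecewise_linear_slack_affine:
  assumes "breakpoint_seq n xs" "piecewise_linear n xs \<theta>" "F \<in> complex2 n xs"
  obtains v c where "\<And>q. q \<in> rel_interior F \<Longrightarrow> slack \<theta> q = v \<bullet> q + c"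
proof (cases "F = {}")
  case True
  then show ?thesis using that by simp
next
  case False
  obtain I J K where IJK: "I \<in> complex1 n xs" "J \<in> complex1 n xs" "K \<in> complex1 n xs"
    and ri: "rel_interior F = face2 (rel_interior I) (rel_interior J) (rel_interior K)"
    using complex2_reduced[OF assms(1,3) False] by metis
  obtain a b where ab: "\<forall>x\<in>rel_interior I. \<theta> x = a * x + b"
    using assms(2) IJK(1) unfolding piecewise_linear_def by blast
  obtain a' b' where ab': "\<forall>x\<in>rel_interior J. \<theta> x = a' * x + b'"
    using assms(2) IJK(2) unfolding piecewise_linear_def by blast
  obtain a'' b'' where ab'': "\<forall>x\<in>rel_interior K. \<theta> x = a'' * x + b''"
    using assms(2) IJK(3) unfolding piecewise_linear_def by blast
  show ?thesis
  proof (rule that[of "(a - a'', a' - a'')" "b + b' - b''"])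
    fix q assume "q \<in> rel_interior F"
    then show "slack \<theta> q = (a - a'', a' - a'') \<bullet> q + (b + b' - b'')"
      using ab ab' ab'' by (cases q) (simp add: ri slack_eq algebra_simps)
  qed
qed

text \<open>
  Periodicity carries the description of \<open>\<mu>\<close> on the cells in the unit interval to all translated cells.
\<close>
lemma restricted_micro_on_cell:
  assumes "restricted_micro n xs T \<mu>" "k < n"
  obtains m c b where
    "\<And>x t i. \<lbrakk>xs k + of_int t < x; x < xs (Suc k) + of_int t; i < m; x - of_int t - b i \<in> T\<rbrakk>
      \<Longrightarrow> \<mu> x = c i"
    "\<And>x t. \<lbrakk>xs k + of_int t < x; x < xs (Suc k) + of_int t;
      \<And>i. i < (m::nat) \<Longrightarrow> x - of_int t - b i \<notin> T\<rbrakk> \<Longrightarrow> \<mu> x = 0"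
proof -
  obtain m :: nat and c b where mcb: "\<forall>x\<in>interior {xs k .. xs (Suc k)}.
      (\<forall>i<m. x - b i \<in> T \<longrightarrow> \<mu> x = c i) \<and> ((\<forall>i<m. x - b i \<notin> T) \<longrightarrow> \<mu> x = 0)"
    using assms unfolding restricted_micro_def by blast
  have periodic: "\<mu> (x - of_int t) = \<mu> x" for x t
    using assms(1) unfolding restricted_micro_def int_periodic_def by (metis diff_add_cancel)
  have int: "x - of_int t \<in> interior {xs k .. xs (Suc k)}"
    if "xs k + of_int t < x" "x < xs (Suc k) + of_int t" for x t
    using that by (simp add: interior_atLeastAtMost_real)
  show ?thesis
  proof (rule that[of m b c])
    fix x t i assume "xs k + of_int t < x" "x < xs (Suc k) + of_int t" "i < m"
      "x - of_int t - b i \<in> T"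
    then show "\<mu> x = c i"
      using mcb[rule_format, OF int] periodic by metis
  next
    fix x t assume "xs k + of_int t < x" "x < xs (Suc k) + of_int t"
      "\<And>i. i < m \<Longrightarrow> x - of_int t - b i \<notin> T"
    then show "\<mu> x = 0"
      using mcb[rule_format, OF int] periodic by metis
  qed
qed

lemma restricted_micro_breakpoint:
  "restricted_micro n xs T \<mu> \<Longrightarrow> x \<in> breakpoints n xs \<Longrightarrow> \<mu> x = 0"
  unfolding restricted_micro_def by blast

lemma restricted_micro_translate:
  assumes "breakpoint_seq n xs" "restricted_micro n xs (group_closure G) \<mu>" "I \<in> complex1 n xs"
    and "x \<in> rel_interior I" "y \<in> rel_interior I" "y - x \<in> group_closure G"
  shows "\<mu> y = \<mu> x"
proof -
  have "I \<noteq> {}"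
    using assms(4) by auto
  with assms(1,3) show ?thesis
  proof (cases rule: complex1_cases)
    case (point a)
    then show ?thesis
      using assms by simp
  next
    case (interval k t)
    obtain m c b where mcb:
      "\<And>x t i. \<lbrakk>xs k + of_int t < x; x < xs (Suc k) + of_int t; i < m;
          x - of_int t - b i \<in> group_closure G\<rbrakk> \<Longrightarrow> \<mu> x = c i"
      "\<And>x t. \<lbrakk>xs k + of_int t < x; x < xs (Suc k) + of_int t;
        \<And>i. i < (m::nat) \<Longrightarrow> x - of_int t - b i \<notin> group_closure G\<rbrakk> \<Longrightarrow> \<mu> x = 0"
      using restricted_micro_on_cell[OF assms(2) interval(1)] by metis
    have x: "xs k + of_int t < x" "x < xs (Suc k) + of_int t"
      and y: "xs k + of_int t < y" "y < xs (Suc k) + of_int t"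
      using assms(4,5) interval by auto
    have iff: "y - of_int t - b i \<in> group_closure G \<longleftrightarrow> x - of_int t - b i \<in> group_closure G" for i
    proof
      assume "y - of_int t - b i \<in> group_closure G"
      from group_closure.diff[OF this assms(6)]
      have "y - of_int t - b i - (y - x) \<in> group_closure G" .
      also have "y - of_int t - b i - (y - x) = x - of_int t - b i"
        by simp
      finally show "x - of_int t - b i \<in> group_closure G" .
    next
      assume "x - of_int t - b i \<in> group_closure G"
      from group_closure_add[OF this assms(6)]
      have "x - of_int t - b i + (y - x) \<in> group_closure G" .
      also have "x - of_int t - b i + (y - x) = y - of_int t - b i"
        by simp
      finally show "y - of_int t - b i \<in> group_closure G" .
    qed
    show ?thesis
    proof (cases "\<exists>i<m. x - of_int t - b i \<in> group_closure G")
      case True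
      then show ?thesis
        using mcb(1)[OF x] mcb(1)[OF y] iff by metis
    next
      case False
      then show ?thesis
        using mcb(2)[OF x] mcb(2)[OF y] iff by metis
    qed
  qed
qed

lemma countable_restricted_micro_support:
  assumes "breakpoint_seq n xs" "restricted_micro n xs T \<mu>" "countable T"
  shows "countable {x. \<mu> x \<noteq> 0}"
proof -
  define cell where
    "cell k t = {x. \<mu> x \<noteq> 0 \<and> xs k + of_int t < x \<and> x < xs (Suc k) + of_int t}" for k and t :: int
  have "countable (cell k t)" if "k < n" for k t
  proof -
    obtain m b where
      "\<And>x t. \<lbrakk>xs k + of_int t < x; x < xs (Suc k) + of_int t;
        \<And>i. i < (m::nat) \<Longrightarrow> x - of_int t - b i \<notin> T\<rbrakk> \<Longrightarrow> \<mu> x = 0"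
      using restricted_micro_on_cell[OF assms(2) \<open>k < n\<close>] by metis
    then have "cell k t \<subseteq> (\<Union>i<m. (\<lambda>\<tau>. \<tau> + of_int t + b i) ` T)"
      unfolding cell_def by (force simp: image_iff)
    then show ?thesis
      by (rule countable_subset) (use assms(3) in auto)
  qed
  then have "countable (\<Union>k<n. \<Union>t. cell k t)"
    by auto
  moreover have "{x. \<mu> x \<noteq> 0} \<subseteq> (\<Union>k<n. \<Union>t. cell k t)"
  proof
    fix x assume "x \<in> {x. \<mu> x \<noteq> 0}"
    then have "\<mu> x \<noteq> 0" by simp
    obtain k t where "k < n"
      "x = xs k + of_int t \<or> xs k + of_int t < x \<and> x < xs (Suc k) + of_int t"
      using carrier_face_exists[OF assms(1)] by metis
    with \<open>\<mu> x \<noteq> 0\<close> show "x \<in> (\<Union>k<n. \<Union>t. cell k t)"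
      using restricted_micro_breakpoint[OF assms(2)] breakpoint_interval_ends(1)[OF assms(1)]
      unfolding cell_def by blast
  qed
  ultimately show ?thesis
    by (rule countable_subset[rotated])
qed

lemma periodic_bounded_if_bounded_on_cells:
  assumes "breakpoint_seq n xs" "int_periodic \<theta>"
    and "\<And>k. k < n \<Longrightarrow> bounded (\<theta> ` {xs k <..< xs (Suc k)})"
  shows "bounded (range \<theta>)"
proof -
  have "range \<theta> \<subseteq> \<theta> ` xs ` {..<n} \<union> (\<Union>k<n. \<theta> ` {xs k <..< xs (Suc k)})"
  proof
    fix z assume "z \<in> range \<theta>"
    then obtain x where z: "z = \<theta> x" by blast
    obtain k t where k: "k < n" "x = xs k + of_int t \<or> xs k + of_int t < x \<and> x < xs (Suc k) + of_int t"
      using carrier_face_exists[OF assms(1)] by metis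
    have "\<theta> (x - of_int t) = \<theta> x"
      using assms(2) unfolding int_periodic_def by (metis diff_add_cancel)
    moreover have "x - of_int t \<in> xs ` {..<n} \<union> (\<Union>k<n. {xs k <..< xs (Suc k)})"
      using k by force
    ultimately show "z \<in> \<theta> ` xs ` {..<n} \<union> (\<Union>k<n. \<theta> ` {xs k <..< xs (Suc k)})"
      unfolding z by (metis image_UN image_Un image_eqI)
  qed
  moreover have "bounded (\<theta> ` xs ` {..<n} \<union> (\<Union>k<n. \<theta> ` {xs k <..< xs (Suc k)}))"
    using assms(3) by (auto intro: finite_imp_bounded)
  ultimately show ?thesis
    by (rule bounded_subset[rotated])
qed

lemma bounded_restricted_micro:
  assumes "breakpoint_seq n xs" "restricted_micro n xs T \<mu>"
  shows "bounded (range \<mu>)"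
proof (rule periodic_bounded_if_bounded_on_cells[OF assms(1)])
  show "int_periodic \<mu>"
    using assms(2) by (simp add: restricted_micro_def)
  fix k assume "k < n"
  then obtain m c b where mcb:
      "\<And>x t i. \<lbrakk>xs k + of_int t < x; x < xs (Suc k) + of_int t; i < m;
          x - of_int t - b i \<in> T\<rbrakk> \<Longrightarrow> \<mu> x = c i"
      "\<And>x t. \<lbrakk>xs k + of_int t < x; x < xs (Suc k) + of_int t;
        \<And>i. i < (m::nat) \<Longrightarrow> x - of_int t - b i \<notin> T\<rbrakk> \<Longrightarrow> \<mu> x = 0"
    using restricted_micro_on_cell[OF assms(2)] by metis
  have "\<mu> ` {xs k <..< xs (Suc k)} \<subseteq> insert 0 (c ` {..<m})"
  proof
    fix z assume "z \<in> \<mu> ` {xs k <..< xs (Suc k)}"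
    then obtain x where x: "z = \<mu> x" "xs k + of_int 0 < x" "x < xs (Suc k) + of_int 0"
      by auto
    then show "z \<in> insert 0 (c ` {..<m})"
      using mcb(1)[OF x(2,3)] mcb(2)[OF x(2,3)] by (metis image_eqI insertCI lessThan_iff)
  qed
  then show "bounded (\<mu> ` {xs k <..< xs (Suc k)})"
    by (rule bounded_subset[rotated]) (simp add: finite_imp_bounded)
qed

lemma bounded_piecewise_linear:
  assumes "breakpoint_seq n xs" "int_periodic \<theta>" "piecewise_linear n xs \<theta>"
  shows "bounded (range \<theta>)"
proof (rule periodic_bounded_if_bounded_on_cells[OF assms(1,2)])
  fix k assume "k < n"
  then have "{xs k + of_int 0 .. xs (Suc k) + of_int 0} \<in> complex1 n xs"
    unfolding complex1_def by blast
  then have "{xs k .. xs (Suc k)} \<in> complex1 n xs"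
    by simp
  moreover have "xs k < xs (Suc k)"
    using assms(1) \<open>k < n\<close> by (simp add: breakpoint_seq_def)
  ultimately obtain a b where "\<forall>x\<in>{xs k <..< xs (Suc k)}. \<theta> x = a * x + b"
    using assms(3) unfolding piecewise_linear_def by force
  then have "\<theta> ` {xs k <..< xs (Suc k)} = (\<lambda>x. a * x + b) ` {xs k <..< xs (Suc k)}"
    by (intro image_cong) auto
  also have "\<dots> \<subseteq> (\<lambda>x. a * x + b) ` {xs k .. xs (Suc k)}"
    by auto
  finally show "bounded (\<theta> ` {xs k <..< xs (Suc k)})"
    by (rule bounded_subset[rotated])
      (intro compact_imp_bounded compact_continuous_image continuous_intros compact_Icc)
qed

section \<open>The microperiodic slack on a face of positive dimension\<close>

text \<open>
  Directions spanning a face of positive dimension can be chosen integral, so that moving along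
  them by elements of \<open>T\<close> changes all three coordinates \<open>x\<close>, \<open>y\<close>, \<open>x + y\<close> by elements of \<open>T\<close>.
  On an edge the second direction is \<open>0\<close>, which gives edges and two-dimensional faces the same
  parametrization. A coordinate that is constant on such a face is a breakpoint: in a triple whose
  open cells meet, if two of the three cells were single points then the face would be a point, and
  if none is then the face is two-dimensional.
\<close>
lemma complex2_directions:
  assumes "breakpoint_seq n xs" "F \<in> complex2 n xs" "aff_dim F > 0"
  obtains d e :: "real \<times> real"
  where "{fst d, snd d, fst e, snd e} \<subseteq> {-1, 0, 1}"
    and "\<And>p q. \<lbrakk>p \<in> rel_interior F; q \<in> rel_interior F\<rbrakk> \<Longrightarrow> \<exists>s t. q = p + s *\<^sub>R d + t *\<^sub>R e"
    and "\<And>p. p \<in> rel_interior F \<Longrightarrow> open {w. p + fst w *\<^sub>R d + snd w *\<^sub>R e \<in> rel_interior F}"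
    and "fst d \<noteq> 0 \<or> fst e \<noteq> 0 \<or> fst ` rel_interior F \<subseteq> breakpoints n xs"
    and "snd d \<noteq> 0 \<or> snd e \<noteq> 0 \<or> snd ` rel_interior F \<subseteq> breakpoints n xs"
    and "fst d + snd d \<noteq> 0 \<or> fst e + snd e \<noteq> 0 \<or>
      (\<lambda>q. fst q + snd q) ` rel_interior F \<subseteq> breakpoints n xs"
proof -
  have "F \<noteq> {}"
    using assms(3) by auto
  then obtain I J K where IJK: "I \<in> complex1 n xs" "J \<in> complex1 n xs" "K \<in> complex1 n xs"
    and F: "F = face2 I J K"
    and ri: "rel_interior F = face2 (rel_interior I) (rel_interior J) (rel_interior K)"
    and ne: "rel_interior F \<noteq> {}"
    using complex2_reduced[OF assms(1,2)] by metis
  have point_or_open: "(\<exists>a\<in>breakpoints n xs. I' = {a}) \<or> open (rel_interior I')"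
    if "I' \<in> complex1 n xs" "rel_interior I' \<noteq> {}" for I'
  proof -
    have "I' \<noteq> {}" using that(2) by auto
    with assms(1) that(1) show ?thesis
      by (cases rule: complex1_cases) auto
  qed
  have flat: False if "F \<subseteq> {p}" for p
    using aff_dim_subset[OF that] assms(3) by simp
  have open_line: "open {w :: real \<times> real. a + fst w * \<alpha> + snd w * \<beta> \<in> S}" if "open S"
    for S :: "real set" and a \<alpha> \<beta>
    using open_vimage[OF that, of "\<lambda>w. a + fst w * \<alpha> + snd w * \<beta>"]
    by (simp add: vimage_def continuous_intros)
  have "rel_interior I \<noteq> {}" "rel_interior J \<noteq> {}" "rel_interior K \<noteq> {}"
    using ne ri by (auto simp: face2_def)
  then consider
      (two_dim) "open (rel_interior I)" "open (rel_interior J)" "open (rel_interior K)"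
    | (vertical) a where "a \<in> breakpoints n xs" "I = {a}" "open (rel_interior J)" "open (rel_interior K)"
    | (horizontal) b where "b \<in> breakpoints n xs" "J = {b}" "open (rel_interior I)" "open (rel_interior K)"
    | (diagonal) c where "c \<in> breakpoints n xs" "K = {c}" "open (rel_interior I)" "open (rel_interior J)"
    | a b where "I = {a}" "J = {b}" | a c where "I = {a}" "K = {c}" | b c where "J = {b}" "K = {c}"
    using point_or_open[OF IJK(1)] point_or_open[OF IJK(2)] point_or_open[OF IJK(3)] by metis
  then show ?thesis
  proof cases
    case two_dim
    show ?thesis
    proof (rule that[of "(1, 0)" "(0, 1)"])
      show "\<exists>s t. q = p + s *\<^sub>R (1, 0) + t *\<^sub>R (0, 1)" for p q :: "real \<times> real"
        by (intro exI[of _ "fst q - fst p"] exI[of _ "snd q - snd p"]) (simp add: prod_eq_iff)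
      fix p :: "real \<times> real"
      show "open {w. p + fst w *\<^sub>R (1, 0) + snd w *\<^sub>R (0, 1) \<in> rel_interior F}"
        using open_line[OF two_dim(1), of "fst p" 1 0] open_line[OF two_dim(2), of "snd p" 0 1]
          open_line[OF two_dim(3), of "fst p + snd p" 1 1]
        by (auto simp: ri algebra_simps intro!: open_Collect_conj)
    qed auto
  next
    case vertical
    show ?thesis
    proof (rule that[of "(0, 1)" "(0, 0)"])
      fix p q assume p: "p \<in> rel_interior F" and q: "q \<in> rel_interior F"
      then show "\<exists>s t. q = p + s *\<^sub>R (0, 1) + t *\<^sub>R (0, 0)"
        using vertical by (intro exI[of _ "snd q - snd p"]) (simp add: prod_eq_iff ri)
    next
      fix p assume p: "p \<in> rel_interior F"
      then show "open {w. p + fst w *\<^sub>R (0, 1) + snd w *\<^sub>R (0, 0) \<in> rel_interior F}"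
        using open_line[OF vertical(3), of "snd p" 1 0] vertical(2)
          open_line[OF vertical(4), of "fst p + snd p" 1 0]
        by (auto simp: ri algebra_simps intro!: open_Collect_conj)
    qed (use vertical in \<open>auto simp: ri\<close>)
  next
    case horizontal
    show ?thesis
    proof (rule that[of "(1, 0)" "(0, 0)"])
      fix p q assume p: "p \<in> rel_interior F" and q: "q \<in> rel_interior F"
      then show "\<exists>s t. q = p + s *\<^sub>R (1, 0) + t *\<^sub>R (0, 0)"
        using horizontal by (intro exI[of _ "fst q - fst p"]) (simp add: prod_eq_iff ri)
    next
      fix p assume p: "p \<in> rel_interior F"
      then show "open {w. p + fst w *\<^sub>R (1, 0) + snd w *\<^sub>R (0, 0) \<in> rel_interior F}"
        using open_line[OF horizontal(3), of "fst p" 1 0] horizontal(2)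
          open_line[OF horizontal(4), of "fst p + snd p" 1 0]
        by (auto simp: ri algebra_simps intro!: open_Collect_conj)
    qed (use horizontal in \<open>auto simp: ri\<close>)
  next
    case diagonal
    show ?thesis
    proof (rule that[of "(1, -1)" "(0, 0)"])
      fix p q assume p: "p \<in> rel_interior F" and q: "q \<in> rel_interior F"
      then have "fst p + snd p = c" "fst q + snd q = c"
        using diagonal by (auto simp: ri)
      then show "\<exists>s t. q = p + s *\<^sub>R (1, -1) + t *\<^sub>R (0, 0)"
        by (intro exI[of _ "fst q - fst p"]) (simp add: prod_eq_iff)
    next
      fix p assume p: "p \<in> rel_interior F"
      then show "open {w. p + fst w *\<^sub>R (1, -1) + snd w *\<^sub>R (0, 0) \<in> rel_interior F}"
        using open_line[OF diagonal(3), of "fst p" 1 0] diagonal(2)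
          open_line[OF diagonal(4), of "snd p" "-1" 0]
        by (auto simp: ri algebra_simps intro!: open_Collect_conj)
    qed (use diagonal in \<open>auto simp: ri\<close>)
  next
    case (5 a b)
    then have "F \<subseteq> {(a, b)}"
      by (auto simp: F face2_def)
    then show ?thesis
      using flat by blast
  next
    case (6 a c)
    then have "F \<subseteq> {(a, c - a)}"
      by (auto simp: F face2_def)
    then show ?thesis
      using flat by blast
  next
    case (7 b c)
    then have "F \<subseteq> {(c - b, b)}"
      by (auto simp: F face2_def)
    then show ?thesis
      using flat by blast
  qed
qed

text \<open>
  Translating along the face by elements of the dense group \<open>T\<close> preserves the slack and brings
  every point of the relative interior arbitrarily close to the limit point; hence the slack is
  constant there and equals the limit. At a generic point each of the three coordinates either
  avoids the countable support of \<open>\<mu>\<close> or is a breakpoint, so the constant is \<open>0\<close>.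
\<close>
lemma restricted_micro_slack_zero_if_limit:
  assumes bp: "breakpoint_seq n xs" and F: "F \<in> complex2 n xs" "aff_dim F > 0"
    and G: "countable G" "closure (group_closure G) = UNIV"
    and micro: "restricted_micro n xs (group_closure G) \<mu>"
    and p: "p \<in> F" and lim: "slack_limit \<mu> F p l"
    and q: "q \<in> rel_interior F"
  shows "slack \<mu> q = 0"
proof -
  let ?T = "group_closure G" and ?R = "rel_interior F"
  obtain d e :: "real \<times> real" where
        coeff: "{fst d, snd d, fst e, snd e} \<subseteq> {-1, 0, 1}"
    and reach: "\<And>p q. \<lbrakk>p \<in> ?R; q \<in> ?R\<rbrakk> \<Longrightarrow> \<exists>s t. q = p + s *\<^sub>R d + t *\<^sub>R e"
    and opn: "\<And>p. p \<in> ?R \<Longrightarrow> open {w. p + fst w *\<^sub>R d + snd w *\<^sub>R e \<in> ?R}"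
    and fix1: "fst d \<noteq> 0 \<or> fst e \<noteq> 0 \<or> fst ` ?R \<subseteq> breakpoints n xs"
    and fix2: "snd d \<noteq> 0 \<or> snd e \<noteq> 0 \<or> snd ` ?R \<subseteq> breakpoints n xs"
    and fix3: "fst d + snd d \<noteq> 0 \<or> fst e + snd e \<noteq> 0 \<or>
      (\<lambda>q. fst q + snd q) ` ?R \<subseteq> breakpoints n xs"
    by (rule complex2_directions[OF bp F]) (rule that; assumption)
  have "F \<noteq> {}"
    using p by blast
  then obtain I J K where IJK: "I \<in> complex1 n xs" "J \<in> complex1 n xs" "K \<in> complex1 n xs"
    and ri: "?R = face2 (rel_interior I) (rel_interior J) (rel_interior K)"
    using complex2_reduced[OF bp F(1)] by metis
  have mult: "s * a \<in> ?T" if "s \<in> ?T" "a \<in> {-1, 0, 1}" for s a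
    using that by auto
  have const: "slack \<mu> r = l" if r: "r \<in> ?R" for r
  proof (rule slack_limit_frequent_value[OF lim])
    fix U :: "(real \<times> real) set" assume U: "open U" "p \<in> U"
    have "p \<in> closure ?R"
      using p convex_closure_rel_interior[OF convex_complex2[OF F(1)]] closure_subset by blast
    then obtain u where u: "u \<in> U" "u \<in> ?R"
      using U open_Int_closure_eq_empty[of U ?R] by blast
    obtain s t where st: "u = r + s *\<^sub>R d + t *\<^sub>R e"
      using reach[OF r u(2)] by blast
    define W where "W = {w. r + fst w *\<^sub>R d + snd w *\<^sub>R e \<in> U} \<inter> {w. r + fst w *\<^sub>R d + snd w *\<^sub>R e \<in> ?R}"
    have "open {w. r + fst w *\<^sub>R d + snd w *\<^sub>R e \<in> U}"
      using open_vimage[OF U(1), of "\<lambda>w. r + fst w *\<^sub>R d + snd w *\<^sub>R e"]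
      by (simp add: vimage_def continuous_intros)
    then have "open W"
      using opn[OF r] by (simp add: W_def open_Int)
    moreover have "(s, t) \<in> W"
      using u st by (simp add: W_def)
    moreover have "closure (?T \<times> ?T) = UNIV"
      using G(2) by (simp add: closure_Times)
    ultimately have "W \<inter> (?T \<times> ?T) \<noteq> {}"
      using open_Int_closure_eq_empty[of W "?T \<times> ?T"] by blast
    then obtain s' t' where st': "(s', t') \<in> W" "s' \<in> ?T" "t' \<in> ?T"
      by blast
    define q' where "q' = r + s' *\<^sub>R d + t' *\<^sub>R e"
    have q': "q' \<in> U" "q' \<in> ?R"
      using st'(1) by (auto simp: W_def q'_def)
    have move: "fst q' - fst r \<in> ?T" "snd q' - snd r \<in> ?T"
      using coeff st'(2,3) by (auto simp: q'_def intro!: group_closure_add mult)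
    have "(fst q' + snd q') - (fst r + snd r) = (fst q' - fst r) + (snd q' - snd r)"
      by simp
    with move have "(fst q' + snd q') - (fst r + snd r) \<in> ?T"
      by (simp only: group_closure_add)
    with move have "\<mu> (fst q') = \<mu> (fst r)" "\<mu> (snd q') = \<mu> (snd r)"
      "\<mu> (fst q' + snd q') = \<mu> (fst r + snd r)"
      using r q'(2) unfolding ri in_face2
      by (blast intro: restricted_micro_translate[OF bp micro IJK(1)]
          restricted_micro_translate[OF bp micro IJK(2)]
          restricted_micro_translate[OF bp micro IJK(3)])+
    then have "slack \<mu> q' = slack \<mu> r"
      by (simp add: slack_eq)
    with q' show "\<exists>q\<in>U \<inter> ?R. slack \<mu> q = slack \<mu> r"
      by blast
  qed
  define N where "N = {x. \<mu> x \<noteq> 0}"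
  have N: "countable N"
    unfolding N_def using bp micro countable_group_closure[OF G(1)]
    by (rule countable_restricted_micro_support)
  define pt where "pt w = q + fst w *\<^sub>R d + snd w *\<^sub>R e" for w
  \<comment> \<open>A zero direction is exempted: then the coordinate is constant on the face, hence a breakpoint.\<close>
  define bad where "bad c v = (if v = 0 then {} else {w. c + v \<bullet> w \<in> N})" for c and v :: "real \<times> real"
  have "negligible (bad c v)" for c v
    by (auto simp: bad_def intro: negligible_countable_level_sets[OF N])
  moreover have "\<not> negligible {w. pt w \<in> ?R}"
  proof (rule open_not_negligible)
    show "open {w. pt w \<in> ?R}"
      using opn[OF q] by (simp add: pt_def)
    have "pt 0 \<in> ?R"
      using q by (simp add: pt_def)
    then show "{w. pt w \<in> ?R} \<noteq> {}" by blast
  qed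
  ultimately have "\<not> {w. pt w \<in> ?R} \<subseteq> bad (fst q) (fst d, fst e) \<union> bad (snd q) (snd d, snd e) \<union>
      bad (fst q + snd q) (fst d + snd d, fst e + snd e)"
    by (meson negligible_Un negligible_subset)
  then obtain w where w: "pt w \<in> ?R" "w \<notin> bad (fst q) (fst d, fst e)"
      "w \<notin> bad (snd q) (snd d, snd e)" "w \<notin> bad (fst q + snd q) (fst d + snd d, fst e + snd e)"
    by blast
  have coord: "fst (pt w) = fst q + (fst d, fst e) \<bullet> w" "snd (pt w) = snd q + (snd d, snd e) \<bullet> w"
    "fst (pt w) + snd (pt w) = fst q + snd q + (fst d + snd d, fst e + snd e) \<bullet> w"
    by (cases w; simp add: pt_def algebra_simps)+
  have bpz: "\<mu> x = 0" if "x \<in> breakpoints n xs" for x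
    using micro that by (rule restricted_micro_breakpoint)
  have "\<mu> (fst (pt w)) = 0"
    using w(1,2) fix1 bpz by (auto simp: bad_def N_def coord zero_prod_def split: if_splits)
  moreover have "\<mu> (snd (pt w)) = 0"
    using w(1,3) fix2 bpz by (auto simp: bad_def N_def coord zero_prod_def split: if_splits)
  moreover have "\<mu> (fst (pt w) + snd (pt w)) = 0"
    using w(1,4) fix3 bpz by (auto simp: bad_def N_def coord(3) zero_prod_def split: if_splits)
  ultimately have "slack \<mu> (pt w) = 0"
    by (simp add: slack_eq)
  then show ?thesis
    using const[OF w(1)] const[OF q] by simp
qed

section \<open>Comparing the slacks of a perturbation and of the function\<close>

lemma polytope_complex2:
  assumes "F \<in> complex2 n xs"
  shows "polytope F"
proof -
  have Icc: "\<exists>a b. I = {a..b}" if "I \<in> complex1 n xs" for I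
  proof -
    have "{} = {1..0::real}" "{x} = {x..x}" for x :: real
      by auto
    then show ?thesis
      using that unfolding complex1_def by blast
  qed
  obtain I J K where IJK: "I \<in> complex1 n xs" "J \<in> complex1 n xs" "K \<in> complex1 n xs"
    and "F = face2 I J K"
    using assms by (auto simp: complex2_face2)
  with Icc[of I] Icc[of J] Icc[of K] obtain a a' b b' c c'
    where F: "F = face2 {a..a'} {b..b'} {c..c'}"
    by blast
  have "F = cbox (a, b) (a', b') \<inter> {p. (1, 1) \<bullet> p \<le> c'} \<inter> {p. (-1, -1) \<bullet> p \<le> - c}"
    unfolding F by (auto simp: cbox_Pair_eq face2_def)
  moreover have "polyhedron (cbox (a, b) (a', b'))"
    by (simp add: polytope_interval polytope_imp_polyhedron)
  moreover have "bounded (cbox (a, b) (a', b') \<inter> {p. (1, 1) \<bullet> p \<le> c'} \<inter> {p. (-1, -1) \<bullet> p \<le> - c})"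
    by (rule bounded_subset[OF bounded_cbox[of "(a, b)" "(a', b')"]]) blast
  ultimately show ?thesis
    by (simp add: polytope_eq_bounded_polyhedron polyhedron_halfspace_le)
qed

text \<open>
  It suffices to compare the two affine functions at the finitely many vertices, because the
  inequality to be proved defines a convex set.
\<close>
lemma affine_dominated_on_polytope:
  fixes P :: "'a::euclidean_space set"
  assumes "polytope P" "\<And>p. p \<in> P \<Longrightarrow> 0 \<le> v \<bullet> p + c"
    and "\<And>p. \<lbrakk>p \<in> P; v \<bullet> p + c = 0\<rbrakk> \<Longrightarrow> v' \<bullet> p + c' = 0"
  obtains C where "C \<ge> 0" "\<And>p. p \<in> P \<Longrightarrow> \<bar>v' \<bullet> p + c'\<bar> \<le> C * (v \<bullet> p + c)"
proof -
  obtain V where V: "finite V" "P = convex hull V"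
    using assms(1) unfolding polytope_def by blast
  then have VP: "V \<subseteq> P"
    by (simp add: hull_subset)
  \<comment> \<open>Vertices where the denominator vanishes contribute \<open>0\<close>, as \<open>x / 0 = 0\<close>; there both sides vanish.\<close>
  define C where "C = (\<Sum>x\<in>V. \<bar>v' \<bullet> x + c'\<bar> / (v \<bullet> x + c))"
  have nn: "0 \<le> \<bar>v' \<bullet> x + c'\<bar> / (v \<bullet> x + c)" if "x \<in> V" for x
    using that VP assms(2) by (intro divide_nonneg_nonneg) auto
  have vertex: "\<bar>v' \<bullet> x + c'\<bar> \<le> C * (v \<bullet> x + c)" if x: "x \<in> V" for x
  proof (cases "v \<bullet> x + c = 0")
    case True
    then show ?thesis
      using assms(3) VP x by auto
  next
    case False
    then have pos: "0 < v \<bullet> x + c"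
      using assms(2) VP x by (metis less_eq_real_def subsetD)
    have "\<bar>v' \<bullet> x + c'\<bar> / (v \<bullet> x + c) \<le> C"
      unfolding C_def using V(1) x nn by (intro member_le_sum) auto
    with pos show ?thesis
      by (simp add: pos_divide_le_eq)
  qed
  let ?S = "{p. (v' - C *\<^sub>R v) \<bullet> p \<le> C * c - c'} \<inter> {p. (- v' - C *\<^sub>R v) \<bullet> p \<le> C * c + c'}"
  have S: "p \<in> ?S \<longleftrightarrow> \<bar>v' \<bullet> p + c'\<bar> \<le> C * (v \<bullet> p + c)" for p
    by (auto simp: abs_le_iff algebra_simps)
  have "convex ?S"
    by (intro convex_Int convex_halfspace_le)
  moreover have "V \<subseteq> ?S"
    using vertex S by blast
  ultimately have "P \<subseteq> ?S"
    unfolding V(2) by (intro hull_minimal)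
  moreover have "C \<ge> 0"
    unfolding C_def using nn by (rule sum_nonneg)
  ultimately show ?thesis
    using that S by blast
qed

text \<open>
  If the limit slack of \<open>\<pi>\<close> vanishes nowhere on the face, compactness bounds it away from \<open>0\<close>.
  Otherwise, unless the face is a point, the microperiodic slack vanishes on its relative interior;
  so the slack of the perturbation is affine there, and its limit vanishes wherever that of \<open>\<pi>\<close> does.
\<close>
lemma slack_dominated_on_face:
  assumes bp: "breakpoint_seq n xs" and F: "F \<in> complex2 n xs"
    and \<pi>: "piecewise_linear n xs \<pi>" "\<And>q. 0 \<le> slack \<pi> q"
    and \<rho>: "\<And>x. \<rho> x = pwl x + \<mu> x" "piecewise_linear n xs pwl" "\<And>x. \<bar>\<rho> x\<bar> \<le> M"
    and c1: "\<And>p. \<lbrakk>p \<in> F; slack_limit \<pi> F p 0\<rbrakk> \<Longrightarrow> slack_limit \<rho> F p 0"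
    and c2: "\<And>p q. \<lbrakk>aff_dim F > 0; p \<in> F; slack_limit \<pi> F p 0; q \<in> F\<rbrakk> \<Longrightarrow> slack_limit \<mu> F q 0"
  obtains C where "C \<ge> 0" "\<And>q. q \<in> rel_interior F \<Longrightarrow> \<bar>slack \<rho> q\<bar> \<le> C * slack \<pi> q"
proof (cases "F = {}")
  case True
  then show ?thesis
    by (intro that[of 0]) auto
next
  case False
  have conv: "convex F" and poly: "polytope F"
    using F by (rule convex_complex2, rule polytope_complex2)
  obtain v c where vc: "\<And>q. q \<in> rel_interior F \<Longrightarrow> slack \<pi> q = v \<bullet> q + c"
    by (rule piecewise_linear_slack_affine[OF bp \<pi>(1) F]) (rule that; assumption)
  have lim: "slack_limit \<pi> F p (v \<bullet> p + c)" for p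
    using vc by (rule slack_limit_affine)
  have "rel_interior F \<subseteq> {p. v \<bullet> p \<ge> - c}"
  proof
    fix q assume "q \<in> rel_interior F"
    with \<pi>(2)[of q] vc[of q] show "q \<in> {p. v \<bullet> p \<ge> - c}"
      by simp
  qed
  then have "closure (rel_interior F) \<subseteq> {p. v \<bullet> p \<ge> - c}"
    by (intro closure_minimal closed_halfspace_ge)
  then have ge: "0 \<le> v \<bullet> p + c" if "p \<in> F" for p
    using that convex_closure_rel_interior[OF conv] closure_subset[of F] by force
  show ?thesis
  proof (cases "\<exists>p\<in>F. v \<bullet> p + c = 0")
    case True
    then obtain p where p: "p \<in> F" "v \<bullet> p + c = 0" by blast
    then have p0: "slack_limit \<pi> F p 0"
      using lim[of p] by simp
    \<comment> \<open>On a one-point face the slack is trivially affine, so both dimensions can be treated alike.\<close>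
    obtain v' c' where vc': "\<And>q. q \<in> rel_interior F \<Longrightarrow> slack \<rho> q = v' \<bullet> q + c'"
    proof (cases "aff_dim F > 0")
      case True
      obtain v' c' where vc': "\<And>q. q \<in> rel_interior F \<Longrightarrow> slack pwl q = v' \<bullet> q + c'"
        by (rule piecewise_linear_slack_affine[OF bp \<rho>(2) F]) (rule that; assumption)
      have "slack \<rho> q = v' \<bullet> q + c'" if q: "q \<in> rel_interior F" for q
      proof -
        have "slack \<mu> q = 0"
          using slack_limit_at_point c2[OF True p(1) p0] q rel_interior_subset by blast
        then show ?thesis
          using vc'[OF q] by (simp add: slack_eq \<rho>(1))
      qed
      then show ?thesis by (rule that)
    next
      case False
      have "aff_dim F = 0"
        using False \<open>F \<noteq> {}\<close> aff_dim_geq[of F] aff_dim_empty[of F] by linarith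
      then obtain a where "F = {a}"
        using aff_dim_eq_0 by blast
      then show ?thesis
        by (intro that[of 0 "slack \<rho> a"]) auto
    qed
    have "v' \<bullet> q + c' = 0" if "q \<in> F" "v \<bullet> q + c = 0" for q
    proof -
      have "slack_limit \<rho> F q 0"
        using c1[OF that(1)] lim[of q] that(2) by simp
      moreover have "slack_limit \<rho> F q (v' \<bullet> q + c')"
        using vc' by (rule slack_limit_affine)
      ultimately show ?thesis
        using slack_limit_unique[OF conv that(1)] by blast
    qed
    then obtain C where C: "C \<ge> 0" "\<And>p. p \<in> F \<Longrightarrow> \<bar>v' \<bullet> p + c'\<bar> \<le> C * (v \<bullet> p + c)"
      using affine_dominated_on_polytope[OF poly ge] by metis
    show ?thesis
    proof (rule that[OF C(1)])
      fix q assume q: "q \<in> rel_interior F"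
      then have "q \<in> F"
        using rel_interior_subset by blast
      then show "\<bar>slack \<rho> q\<bar> \<le> C * slack \<pi> q"
        using C(2)[of q] vc[OF q] vc'[OF q] by simp
    qed
  next
    case nozero: False
    have "compact F"
      using poly by (rule polytope_imp_compact)
    moreover have "continuous_on F (\<lambda>p. v \<bullet> p + c)"
      by (intro continuous_intros)
    ultimately obtain p0 where p0: "p0 \<in> F" "\<And>p. p \<in> F \<Longrightarrow> v \<bullet> p0 + c \<le> v \<bullet> p + c"
      using continuous_attains_inf[of F "\<lambda>p. v \<bullet> p + c"] \<open>F \<noteq> {}\<close> by blast
    define m where "m = v \<bullet> p0 + c"
    have m: "m > 0"
      using ge[OF p0(1)] nozero p0(1) unfolding m_def by (metis less_eq_real_def)
    have "M \<ge> 0"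
      using \<rho>(3)[of 0] by linarith
    show ?thesis
    proof (rule that[of "3 * M / m"])
      show "3 * M / m \<ge> 0"
        using m \<open>M \<ge> 0\<close> by simp
      fix q assume q: "q \<in> rel_interior F"
      have "\<bar>slack \<rho> q\<bar> \<le> 3 * M"
        using \<rho>(3)[of "fst q"] \<rho>(3)[of "snd q"] \<rho>(3)[of "fst q + snd q"]
        unfolding slack_eq by linarith
      also have "3 * M = 3 * M / m * m"
        using m by simp
      also have "\<dots> \<le> 3 * M / m * slack \<pi> q"
      proof (rule mult_left_mono)
        show "m \<le> slack \<pi> q"
          using p0(2)[of q] q rel_interior_subset vc[OF q] unfolding m_def by auto
      qed (use m \<open>M \<ge> 0\<close> in simp)
      finally show "\<bar>slack \<rho> q\<bar> \<le> 3 * M / m * slack \<pi> q" .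
    qed
  qed
qed

lemma carrier_cell:
  assumes "breakpoint_seq n xs" "k < n"
    "x = xs k + of_int t \<or> xs k + of_int t < x \<and> x < xs (Suc k) + of_int t"
  shows "x \<in> rel_interior {xs k + of_int t} \<or>
    x \<in> rel_interior {xs k + of_int t .. xs (Suc k) + of_int t}"
  using assms(3)
proof
  assume "xs k + of_int t < x \<and> x < xs (Suc k) + of_int t"
  moreover from this have "xs k + of_int t < xs (Suc k) + of_int t"
    by linarith
  ultimately show ?thesis
    by (metis greaterThanLessThan_iff rel_interior_real_box)
qed simp

lemma rel_interior_cover:
  assumes "breakpoint_seq n xs"
  obtains I where "I \<in> complex1 n xs" "x \<in> rel_interior I"
proof -
  obtain k t where kt: "k < n"
    "x = xs k + of_int t \<or> xs k + of_int t < x \<and> x < xs (Suc k) + of_int t"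
    using carrier_face_exists[OF assms] by metis
  then show ?thesis
    using carrier_cell[OF assms kt] cells_complex1[OF kt(1)] that by blast
qed

text \<open>The range up to \<open>2\<close> accommodates the sum of two numbers in the unit interval.\<close>
lemma finite_rel_interior_cover:
  assumes "breakpoint_seq n xs"
  obtains \<C> where "finite \<C>" "\<C> \<subseteq> complex1 n xs"
    "\<And>x. \<lbrakk>0 \<le> x; x < 2\<rbrakk> \<Longrightarrow> \<exists>I\<in>\<C>. x \<in> rel_interior I"
proof -
  define pts ivs where "pts = (\<lambda>(k, t::int). {xs k + of_int t})"
    and "ivs = (\<lambda>(k, t::int). {xs k + of_int t .. xs (Suc k) + of_int t})"
  let ?P = "{..<n} \<times> {0, 1 :: int}"
  show ?thesis
  proof (rule that[of "pts ` ?P \<union> ivs ` ?P"])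
    show "finite (pts ` ?P \<union> ivs ` ?P)"
      by simp
    show "pts ` ?P \<union> ivs ` ?P \<subseteq> complex1 n xs"
      using cells_complex1[of _ n xs 0] cells_complex1[of _ n xs 1] by (auto simp: pts_def ivs_def)
    fix x :: real assume x: "0 \<le> x" "x < 2"
    obtain k t where kt: "k < n" "t = \<lfloor>x\<rfloor>"
      "x = xs k + of_int t \<or> xs k + of_int t < x \<and> x < xs (Suc k) + of_int t"
      using carrier_face_exists[OF assms] by metis
    have "\<lfloor>x\<rfloor> = 0 \<or> \<lfloor>x\<rfloor> = 1"
      using x by linarith
    then have "(k, t) \<in> ?P"
      using kt by auto
    then have "{xs k + of_int t} \<in> pts ` ?P" "{xs k + of_int t .. xs (Suc k) + of_int t} \<in> ivs ` ?P"
      by (auto simp: pts_def ivs_def intro!: rev_image_eqI)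
    then show "\<exists>I\<in>pts ` ?P \<union> ivs ` ?P. x \<in> rel_interior I"
      using carrier_cell[OF assms kt(1,3)] by blast
  qed
qed

lemma slack_periodic:
  assumes "int_periodic \<theta>"
  shows "slack \<theta> (x + of_int s, y + of_int t) = slack \<theta> (x, y)"
proof -
  have "\<theta> (x + of_int s + (y + of_int t)) = \<theta> (x + y + of_int (s + t))"
    by (simp add: algebra_simps)
  then show ?thesis
    using assms by (simp add: slack_eq int_periodic_def del: of_int_add)
qed

text \<open>
  By periodicity only points of the unit square matter, and finitely many faces meet it, so the
  constants found on the individual faces give a global one.
\<close>
lemma slack_dominated:
  assumes bp: "breakpoint_seq n xs"
    and \<pi>: "piecewise_linear n xs \<pi>" "\<And>q. 0 \<le> slack \<pi> q" "int_periodic \<pi>"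
    and \<rho>: "\<And>x. \<rho> x = pwl x + \<mu> x" "piecewise_linear n xs pwl" "\<And>x. \<bar>\<rho> x\<bar> \<le> M" "int_periodic \<rho>"
    and c1: "\<forall>F\<in>complex2 n xs. \<forall>p\<in>F. slack_limit \<pi> F p 0 \<longrightarrow> slack_limit \<rho> F p 0"
    and c2: "\<forall>F\<in>complex2 n xs. aff_dim F > 0 \<and> (\<exists>p\<in>F. slack_limit \<pi> F p 0) \<longrightarrow>
       (\<forall>q\<in>F. slack_limit \<mu> F q 0)"
  obtains C where "C \<ge> 0" "\<And>q. \<bar>slack \<rho> q\<bar> \<le> C * slack \<pi> q"
proof -
  obtain \<C> where \<C>: "finite \<C>" "\<C> \<subseteq> complex1 n xs"
    "\<And>x. \<lbrakk>0 \<le> x; x < 2\<rbrakk> \<Longrightarrow> \<exists>I\<in>\<C>. x \<in> rel_interior I"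
    by (rule finite_rel_interior_cover[OF bp]) (rule that; assumption)
  define \<F> where "\<F> = (\<lambda>(I, J, K). face2 I J K) ` (\<C> \<times> \<C> \<times> \<C>)"
  have fin: "finite \<F>"
    using \<C>(1) by (simp add: \<F>_def)
  have sub: "\<F> \<subseteq> complex2 n xs"
    using \<C>(2) by (force simp: \<F>_def complex2_face2)
  have "\<exists>C\<ge>0. \<forall>q\<in>rel_interior F. \<bar>slack \<rho> q\<bar> \<le> C * slack \<pi> q" if "F \<in> \<F>" for F
  proof -
    have F: "F \<in> complex2 n xs"
      using that sub by blast
    show ?thesis
    proof (rule slack_dominated_on_face[OF bp F \<pi>(1,2) \<rho>(1-3)])
      show "slack_limit \<rho> F p 0" if "p \<in> F" "slack_limit \<pi> F p 0" for p
        using c1 F that by blast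
      show "slack_limit \<mu> F q 0"
        if "aff_dim F > 0" "p \<in> F" "slack_limit \<pi> F p 0" "q \<in> F" for p q
        using c2 F that by blast
    qed blast
  qed
  then obtain D where D: "\<And>F. F \<in> \<F> \<Longrightarrow> D F \<ge> 0"
    "\<And>F q. \<lbrakk>F \<in> \<F>; q \<in> rel_interior F\<rbrakk> \<Longrightarrow> \<bar>slack \<rho> q\<bar> \<le> D F * slack \<pi> q"
    by metis
  show ?thesis
  proof (rule that[of "sum D \<F>"])
    show "sum D \<F> \<ge> 0"
      using D(1) by (rule sum_nonneg)
    fix q :: "real \<times> real"
    define x y where "x = frac (fst q)" and "y = frac (snd q)"
    have q: "q = (x + of_int \<lfloor>fst q\<rfloor>, y + of_int \<lfloor>snd q\<rfloor>)"
      by (simp add: x_def y_def frac_def)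
    have bounds: "0 \<le> x" "x < 1" "0 \<le> y" "y < 1"
      by (simp_all add: x_def y_def frac_lt_1)
    then obtain I J K where IJK: "I \<in> \<C>" "J \<in> \<C>" "K \<in> \<C>"
      "x \<in> rel_interior I" "y \<in> rel_interior J" "x + y \<in> rel_interior K"
      using \<C>(3)[of x] \<C>(3)[of y] \<C>(3)[of "x + y"] by force
    define F where "F = face2 I J K"
    have "F \<in> \<F>"
      using IJK by (force simp: \<F>_def F_def)
    have ne: "(x, y) \<in> face2 (rel_interior I) (rel_interior J) (rel_interior K)"
      using IJK by simp
    have "convex I" "convex J" "convex K"
      using IJK \<C>(2) convex_complex1 by blast+
    then have "(x, y) \<in> rel_interior F"
      unfolding F_def using ne by (subst rel_interior_face2) blast+
    with \<open>F \<in> \<F>\<close> have "\<bar>slack \<rho> (x, y)\<bar> \<le> D F * slack \<pi> (x, y)"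
      by (rule D(2))
    also have "\<dots> \<le> sum D \<F> * slack \<pi> (x, y)"
      using fin \<open>F \<in> \<F>\<close> D(1) by (intro mult_right_mono \<pi>(2) member_le_sum) auto
    finally show "\<bar>slack \<rho> q\<bar> \<le> sum D \<F> * slack \<pi> q"
      by (subst (1 2) q) (simp only: slack_periodic[OF \<rho>(4)] slack_periodic[OF \<pi>(3)])
  qed
qed

section \<open>Minimal valid functions\<close>

lemma subadditive_multiple:
  fixes \<theta> :: "real \<Rightarrow> real"
  assumes "\<And>x y. \<theta> (x + y) \<le> \<theta> x + \<theta> y" "\<theta> 0 = 0"
  shows "\<theta> (real m * x) \<le> real m * \<theta> x"
proof (induction m)
  case 0
  then show ?case by (simp add: assms(2))
next
  case (Suc m)
  then show ?case
    using assms(1)[of "real m * x" x] by (simp add: algebra_simps)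
qed

text \<open>
  Near an interior point of a cell where \<open>\<pi>\<close> attains its maximum, \<open>\<pi>\<close> would be constant. By
  symmetry \<open>\<pi>\<close> would then vanish near \<open>0\<close>, and by subadditivity everywhere, although its
  value at \<open>f\<close> is \<open>1\<close>.
\<close>
lemma minimal_valid_f_breakpoint:
  assumes bp: "breakpoint_seq n xs" and mv: "minimal_valid f \<pi>" and pl: "piecewise_linear n xs \<pi>"
  shows "f \<in> breakpoints n xs"
proof (rule ccontr)
  assume nb: "f \<notin> breakpoints n xs"
  obtain I where I: "I \<in> complex1 n xs" "f \<in> rel_interior I"
    using rel_interior_cover[OF bp] .
  have "I \<noteq> {}"
    using I(2) by auto
  with bp I(1) obtain a b where ab: "I = {a..b}" "a < b"
    by (cases rule: complex1_cases) (use nb I(2) in auto)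
  then have f: "a < f" "f < b"
    using I(2) by auto
  obtain \<alpha> \<beta> where lin: "\<And>x. \<lbrakk>a < x; x < b\<rbrakk> \<Longrightarrow> \<pi> x = \<alpha> * x + \<beta>"
    using pl I(1) ab unfolding piecewise_linear_def by fastforce
  define \<delta> where "\<delta> = min (f - a) (b - f) / 2"
  have \<delta>: "\<delta> > 0" "a < f - \<delta>" "f + \<delta> < b"
    using f by (auto simp: \<delta>_def min_def field_simps)
  have fv: "\<alpha> * f + \<beta> = 1"
    using mv lin[of f] f by (simp add: minimal_valid_def)
  have "\<pi> (f + \<delta>) \<le> 1" "\<pi> (f - \<delta>) \<le> 1"
    using mv unfolding minimal_valid_def by blast+
  then have "\<alpha> * (f + \<delta>) + \<beta> \<le> 1" "\<alpha> * (f - \<delta>) + \<beta> \<le> 1"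
    using lin[of "f + \<delta>"] lin[of "f - \<delta>"] \<delta> f by auto
  with fv have "\<alpha> * \<delta> \<le> 0" "\<alpha> * \<delta> \<ge> 0"
    by (auto simp: algebra_simps)
  then have "\<alpha> = 0"
    using \<delta>(1) by simp
  have zero: "\<pi> z = 0" if "\<bar>z\<bar> < \<delta>" for z
  proof -
    have "\<pi> (f - z) = 1"
      using lin[of "f - z"] that \<delta> \<open>\<alpha> = 0\<close> fv by (simp add: abs_less_iff)
    moreover have "\<pi> z + \<pi> (f - z) = 1"
      using mv unfolding minimal_valid_def by blast
    ultimately show ?thesis
      by simp
  qed
  have sub: "\<pi> (real m * z) \<le> real m * \<pi> z" for m z
    using mv by (intro subadditive_multiple) (auto simp: minimal_valid_def)
  obtain m where m: "\<bar>f\<bar> < real m * \<delta>"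
    using reals_Archimedean3[OF \<delta>(1)] by blast
  then have "m > 0"
    by (cases "m = 0") auto
  with m have "\<bar>f / real m\<bar> < \<delta>"
    by (simp add: abs_divide pos_divide_less_eq mult.commute)
  then have "\<pi> f \<le> 0"
    using sub[of m "f / real m"] zero \<open>m > 0\<close> by simp
  then show False
    using mv by (simp add: minimal_valid_def)
qed

text \<open>
  Nonnegativity is automatic for a bounded subadditive function: a negative value at \<open>x\<close> would
  make the values at the multiples of \<open>x\<close> tend to minus infinity. The upper bound follows from it by
  symmetry.
\<close>
lemma minimal_valid_perturbation:
  assumes mv: "minimal_valid f \<pi>"
    and \<rho>: "int_periodic \<rho>" "\<And>x. \<bar>\<rho> x\<bar> \<le> M" "\<rho> 0 = 0" "\<rho> f = 0" "\<And>x. \<rho> x + \<rho> (f - x) = 0"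
    and dom: "\<And>q. \<bar>slack \<rho> q\<bar> \<le> slack \<pi> q"
  shows "minimal_valid f (\<lambda>x. \<pi> x + \<rho> x)"
proof -
  define \<theta> where "\<theta> = (\<lambda>x. \<pi> x + \<rho> x)"
  have sub: "\<theta> (x + y) \<le> \<theta> x + \<theta> y" for x y
    using dom[of "(x, y)"] by (simp add: slack_eq \<theta>_def)
  have zero: "\<theta> 0 = 0"
    using mv \<rho>(3) by (simp add: \<theta>_def minimal_valid_def)
  have sym: "\<theta> x + \<theta> (f - x) = 1" for x
  proof -
    have "\<pi> x + \<pi> (f - x) = 1"
      using mv unfolding minimal_valid_def by blast
    then show ?thesis
      using \<rho>(5)[of x] by (simp add: \<theta>_def)
  qed
  have mult: "\<theta> (real m * x) \<le> real m * \<theta> x" for m x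
    using sub zero by (rule subadditive_multiple)
  have nonneg: "0 \<le> \<theta> x" for x
  proof (rule ccontr)
    assume "\<not> 0 \<le> \<theta> x"
    then obtain m where "M < real m * (- \<theta> x)"
      using reals_Archimedean3[of "- \<theta> x"] by auto
    then have "\<theta> (real m * x) < - M"
      using mult[of m x] by simp
    moreover have "0 \<le> \<pi> (real m * x)"
      using mv unfolding minimal_valid_def by blast
    ultimately show False
      using \<rho>(2)[of "real m * x"] by (simp add: \<theta>_def)
  qed
  have "\<theta> x \<le> 1" for x
    using sym[of x] nonneg[of "f - x"] by linarith
  moreover have "int_periodic \<theta>"
    using mv \<rho>(1) by (simp add: \<theta>_def minimal_valid_def int_periodic_def)
  moreover have "\<theta> f = 1"
    using sym[of 0] zero by simp
  ultimately have "minimal_valid f \<theta>"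
    unfolding minimal_valid_def using nonneg sub zero sym by blast
  then show ?thesis
    by (simp add: \<theta>_def)
qed

theorem theorem4p3:
  fixes f :: real and n :: nat and xs :: "nat \<Rightarrow> real" and G T :: "real set"
    and \<pi> pbar pwl micro :: "real \<Rightarrow> real"
  assumes "0 < f" and "f < 1"
    and "breakpoint_seq n xs"
    and "minimal_valid f \<pi>" and "piecewise_linear n xs \<pi>"
    and "finite G" and "T = group_closure G" and "closure T = UNIV"
    and "restricted_lqmp n xs T pbar pwl micro"
    and "pbar 0 = 0" and "pbar f = 0"
  shows "pbar \<in> effective_perturbations f \<pi> \<longleftrightarrow>
    (\<forall>F\<in>complex2 n xs. \<forall>p\<in>F. slack_limit \<pi> F p 0 \<longrightarrow> slack_limit pbar F p 0) \<and>
    (\<forall>F\<in>complex2 n xs. aff_dim F > 0 \<and> (\<exists>p\<in>F. slack_limit \<pi> F p 0) \<longrightarrow>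
       (\<forall>q\<in>F. slack_limit micro F q 0))"
    (is "_ \<longleftrightarrow> ?tight \<and> ?micro")
proof
  note bp = assms(3) and mv = assms(4) and pl = assms(5)
  have split: "pbar x = pwl x + micro x" for x
    using assms(9) by (simp add: restricted_lqmp_def)
  have pwl: "piecewise_linear n xs pwl" and restr: "restricted_micro n xs (group_closure G) micro"
    using assms(7,9) by (auto simp: restricted_lqmp_def)
  assume "pbar \<in> effective_perturbations f \<pi>"
  then obtain \<epsilon> where \<epsilon>: "\<epsilon> > 0" "minimal_valid f (\<lambda>x. \<pi> x + \<epsilon> * pbar x)"
    "minimal_valid f (\<lambda>x. \<pi> x - \<epsilon> * pbar x)"
    by (auto simp: effective_perturbations_def)
  have "\<bar>slack pbar q\<bar> \<le> 1 / \<epsilon> * slack \<pi> q" for q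
  proof -
    let ?x = "fst q" and ?y = "snd q"
    have "\<pi> (?x + ?y) + \<epsilon> * pbar (?x + ?y) \<le> \<pi> ?x + \<epsilon> * pbar ?x + (\<pi> ?y + \<epsilon> * pbar ?y)"
      "\<pi> (?x + ?y) - \<epsilon> * pbar (?x + ?y) \<le> \<pi> ?x - \<epsilon> * pbar ?x + (\<pi> ?y - \<epsilon> * pbar ?y)"
      using \<epsilon>(2,3) unfolding minimal_valid_def by blast+
    then have "\<epsilon> * \<bar>slack pbar q\<bar> \<le> slack \<pi> q"
      using \<epsilon>(1) by (auto simp: slack_eq abs_if algebra_simps)
    then show ?thesis
      using \<epsilon>(1) by (simp add: field_simps)
  qed
  then have tight: ?tight
    using slack_limit_zero_if_dominated by blast
  have ?micro
  proof (intro ballI impI)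
    fix F q assume F: "F \<in> complex2 n xs" and "aff_dim F > 0 \<and> (\<exists>p\<in>F. slack_limit \<pi> F p 0)"
    then obtain p where dim: "aff_dim F > 0" and p: "p \<in> F" "slack_limit \<pi> F p 0"
      by blast
    obtain v c where vc: "\<And>q. q \<in> rel_interior F \<Longrightarrow> slack pwl q = v \<bullet> q + c"
      by (rule piecewise_linear_slack_affine[OF bp pwl F]) (rule that; assumption)
    have "slack_limit pbar F p 0"
      using tight F p by blast
    with split vc have "slack_limit micro F p (0 - (v \<bullet> p + c))"
      by (rule slack_limit_remove_affine)
    then have "slack micro q = 0 \<bullet> q + 0" if "q \<in> rel_interior F" for q
      using restricted_micro_slack_zero_if_limit[OF bp F dim _ _ restr p(1)] that assms(6-8)
      by (simp add: countable_finite)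
    then have "slack_limit micro F q (0 \<bullet> q + 0)"
      by (rule slack_limit_affine)
    then show "slack_limit micro F q 0"
      by simp
  qed
  with tight show "?tight \<and> ?micro" by blast
next
  note bp = assms(3) and mv = assms(4) and pl = assms(5)
  have split: "pbar x = pwl x + micro x" for x
    using assms(9) by (simp add: restricted_lqmp_def)
  have pwl: "piecewise_linear n xs pwl" "int_periodic pwl" and restr: "restricted_micro n xs T micro"
    using assms(9) by (auto simp: restricted_lqmp_def)
  assume cond: "?tight \<and> ?micro"
  have per: "int_periodic pbar"
    using pwl(2) restr by (simp add: restricted_micro_def int_periodic_def split)
  have "bounded (range pwl)" "bounded (range micro)"
    using bounded_piecewise_linear[OF bp pwl(2,1)] bounded_restricted_micro[OF bp restr] .
  then obtain M M' where "\<And>x. \<bar>pwl x\<bar> \<le> M" "\<And>x. \<bar>micro x\<bar> \<le> M'"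
    unfolding bounded_iff by (auto simp: real_norm_def)
  then have M: "\<bar>pbar x\<bar> \<le> M + M'" for x
    unfolding split by (meson abs_triangle_ineq add_mono order_trans)
  have nonneg: "0 \<le> slack \<pi> q" for q
    using mv unfolding minimal_valid_def slack_eq by (simp add: algebra_simps)
  \<comment> \<open>The point \<open>(x, f - x)\<close> lies in the relative interior of a face on the line \<open>x + y = f\<close>,
    and the slack of \<open>\<pi>\<close> vanishes there by the symmetry of \<open>\<pi>\<close>.\<close>
  have sym: "pbar x + pbar (f - x) = 0" for x
  proof -
    obtain I J where IJ: "I \<in> complex1 n xs" "x \<in> rel_interior I"
      "J \<in> complex1 n xs" "f - x \<in> rel_interior J"
      using rel_interior_cover[OF bp] by metis
    have K: "{f} \<in> complex1 n xs"
      using minimal_valid_f_breakpoint[OF bp mv pl] by (auto simp: complex1_def)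
    define F where "F = face2 I J {f}"
    have F: "F \<in> complex2 n xs"
      using IJ K by (auto simp: F_def complex2_face2)
    have "(x, f - x) \<in> face2 (rel_interior I) (rel_interior J) (rel_interior {f})"
      using IJ by simp
    then have p: "(x, f - x) \<in> rel_interior F"
      unfolding F_def using IJ K convex_complex1 by (subst rel_interior_face2) blast+
    obtain v c where vc: "\<And>q. q \<in> rel_interior F \<Longrightarrow> slack \<pi> q = v \<bullet> q + c"
      by (rule piecewise_linear_slack_affine[OF bp pl F]) (rule that; assumption)
    have "slack_limit \<pi> F (x, f - x) (v \<bullet> (x, f - x) + c)"
      using vc by (rule slack_limit_affine)
    moreover have "slack \<pi> (x, f - x) = 0"
      using mv by (simp add: slack_eq minimal_valid_def)
    ultimately have "slack_limit \<pi> F (x, f - x) 0"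
      using vc[OF p] by simp
    then have "slack_limit pbar F (x, f - x) 0"
      using cond F p rel_interior_subset by blast
    then have "slack pbar (x, f - x) = 0"
      using p by (rule slack_limit_at_point)
    then show ?thesis
      using assms(11) by (simp add: slack_eq)
  qed
  obtain C where C: "C \<ge> 0" "\<And>q. \<bar>slack pbar q\<bar> \<le> C * slack \<pi> q"
  proof (rule slack_dominated[OF bp pl nonneg _ split pwl(1) M per])
    show "int_periodic \<pi>"
      using mv by (simp add: minimal_valid_def)
    show ?tight ?micro
      using cond by blast+
  qed (rule that; assumption)
  \<comment> \<open>Any \<open>\<epsilon>\<close> with \<open>\<epsilon> * C \<le> 1\<close> would do; adding \<open>1\<close> covers the case \<open>C = 0\<close>.\<close>
  define \<epsilon> where "\<epsilon> = 1 / (C + 1)"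
  have \<epsilon>: "\<epsilon> > 0" "\<epsilon> * C \<le> 1"
    using C(1) by (auto simp: \<epsilon>_def)
  have valid: "minimal_valid f (\<lambda>x. \<pi> x + s * pbar x)" if s: "\<bar>s\<bar> = \<epsilon>" for s
  proof (rule minimal_valid_perturbation[OF mv])
    show "int_periodic (\<lambda>x. s * pbar x)"
      using per by (simp add: int_periodic_def)
    show "\<bar>s * pbar x\<bar> \<le> \<epsilon> * (M + M')" for x
      using M s \<epsilon>(1) by (simp add: abs_mult)
    show "s * pbar 0 = 0" "s * pbar f = 0"
      using assms(10,11) by auto
    show "s * pbar x + s * pbar (f - x) = 0" for x
      using sym[of x] by (metis distrib_left mult_zero_right)
    fix q
    have "\<bar>slack (\<lambda>x. s * pbar x) q\<bar> = \<epsilon> * \<bar>slack pbar q\<bar>"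
      unfolding s[symmetric] abs_mult[symmetric] by (simp add: slack_eq algebra_simps)
    also have "\<dots> \<le> \<epsilon> * (C * slack \<pi> q)"
      using C(2) \<epsilon>(1) by simp
    also have "\<dots> \<le> slack \<pi> q"
      using mult_right_mono[OF \<epsilon>(2) nonneg[of q]] by (simp add: mult.assoc)
    finally show "\<bar>slack (\<lambda>x. s * pbar x) q\<bar> \<le> slack \<pi> q" .
  qed
  show "pbar \<in> effective_perturbations f \<pi>"
    using valid[of \<epsilon>] valid[of "- \<epsilon>"] \<epsilon>(1) by (auto simp: effective_perturbations_def)
qed

end
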